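(* Let $p>0$ be real and $\mathfrak{S}=\{x\in\mathbb{C}: -1\le \operatorname{Im}(x)\le 0\}$. Let $F_o$ be an odd complex function, analytic on an open set (symmetric about $0$) containing $\{x\in\mathbb{C}:|\operatorname{Im}(x)|\le1\}$, such that, uniformly for $x\in\mathfrak{S}$ as $\operatorname{Re}(x)\to\pm\infty$, $F_o(x)^2+F_o(x+i)^2=o\!\left(e^{\pi|x|}/|x|\right)$ and $\dfrac{F_o(x)^2+F_o(x+i)^2}{\sinh(\pi p(2x+i))}\to0$. Assume that the integrand below has no pole on the real axis (automatic if $p$ is not an integer). Then $$\int_{-\infty}^{\infty}\frac{F_o(x)^2+F_o(i+x)^2}{\sinh(\pi p(2x+i))}\,dx=\frac{i}{2p}\sum_{n=\lfloor -p\rfloor}^{-1+\lfloor p\rfloor}(-1)^n\left(F_o\!\left(\frac{i(n+1-p)}{2p}\right)^2+F_o\!\left(\frac{i(n+1+p)}{2p}\right)^2\right).$$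
   Context: The integral over the real line is understood as $\lim_{R\to\infty}\int_{-R}^{R}$ (removable singularities of the integrand being filled in); $\lfloor y\rfloor$ is the greatest integer not exceeding $y$. *)

theory Defs
  imports "HOL-Complex_Analysis.Complex_Analysis"
begin

definition strip :: "complex set" where
  "strip = {x. -1 \<le> Im x \<and> Im x \<le> 0}"

(* A limit or o-estimate along this filter is uniform in Im x. *)
definition strip_ends :: "complex filter" where
  "strip_ends = inf (filtercomap (\<lambda>x. \<bar>Re x\<bar>) at_top) (principal strip)"

lemma eventually_strip_ends:
  "eventually P strip_ends \<longleftrightarrow> (\<exists>R. \<forall>x\<in>strip. \<bar>Re x\<bar> \<ge> R \<longrightarrow> P x)"
proof -
  have "eventually P strip_ends \<longleftrightarrow>
      eventually (\<lambda>x. x \<in> strip \<longrightarrow> P x) (filtercomap (\<lambda>x. \<bar>Re x\<bar>) at_top)"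
    by (simp add: strip_ends_def eventually_inf_principal)
  also have "\<dots> \<longleftrightarrow> (\<exists>R. \<forall>x. \<bar>Re x\<bar> \<ge> R \<longrightarrow> x \<in> strip \<longrightarrow> P x)"
    by (rule eventually_filtercomap_at_top_linorder)
  finally show ?thesis by blast
qed

definition numer :: "(complex \<Rightarrow> complex) \<Rightarrow> complex \<Rightarrow> complex" where
  "numer F x = (F x)\<^sup>2 + (F (x + \<i>))\<^sup>2"

definition integrand :: "real \<Rightarrow> (complex \<Rightarrow> complex) \<Rightarrow> complex \<Rightarrow> complex" where
  "integrand p F x = numer F x / sinh (of_real (pi * p) * (2 * x + \<i>))"

definition has_symmetric_integral :: "(real \<Rightarrow> complex) \<Rightarrow> complex \<Rightarrow> bool" where
  "has_symmetric_integral f I \<longleftrightarrow>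
     (\<forall>R>0. f integrable_on {-R..R}) \<and> ((\<lambda>R. integral {-R..R} f) \<longlongrightarrow> I) at_top"

end

theory Submission
  imports Defs
begin

text \<open>
  Write \<open>f\<close> for the integrand and put \<open>\<rho> z = - z - \<i>\<close>, the point reflection of the strip
  \<open>-1 \<le> Im z \<le> 0\<close> in its centre \<open>-\<i>/2\<close>. Because \<open>F\<close> is odd, the numerator
  \<open>F z ^ 2 + F (z + \<i>) ^ 2\<close> is invariant under \<open>\<rho>\<close>: its two summands are exchanged. The
  denominator \<open>sinh (\<pi> p (2 z + \<i>))\<close> changes sign, so \<open>f (\<rho> z) = - f z\<close>. Hence, along the
  boundary of the rectangle with vertices \<open>\<plusminus>R\<close> and \<open>\<plusminus>R - \<i>\<close>, the top and the bottom edge each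
  contribute minus the integral of \<open>f\<close> over \<open>[-R, R]\<close>, while the vertical edges contribute \<open>o(1)\<close>
  as \<open>f\<close> tends to 0 at the ends of the strip. By the residue theorem the integral over
  the real line is therefore \<open>-\<pi> \<i>\<close> times the sum of the residues of \<open>f\<close> inside the strip
  (lemma \<open>symmetric_integral_strip\<close>).

  The denominator has simple zeros at \<open>\<i> (k - p) / (2 p)\<close> for integers \<open>k\<close>
  (\<open>denom_eq_0_iff\<close> and \<open>denom_deriv_node\<close>). Those with \<open>\<bar>k\<bar> < p\<close> lie inside the strip, and
  \<open>residue_quotient_simple_zero\<close> gives the residues there. With \<open>k = n + 1\<close> this is
  the asserted sum. If \<open>p\<close> is an integer, there are two more zeros on the boundary, namely 0 and
  \<open>-\<i>\<close> (\<open>k = p\<close> and \<open>k = -p\<close>). The absence of real poles forces the numerator to vanish at 0;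
  by the symmetry the singularity at \<open>-\<i>\<close> is removable as well. The asserted sum contains the
  term \<open>k = p\<close>, but that term is 0.
\<close>

section \<open>Residues and point symmetry in a strip\<close>

text \<open>
  Analyticity on the closed rectangle away from \<open>P\<close> only provides an open set around that closed
  set minus \<open>P\<close>. Joining the open rectangle to it gives a neighbourhood of the whole closed
  rectangle, because \<open>P\<close> is interior, and the component containing the rectangle is a domain on
  which the general residue theorem applies.
\<close>

lemma rectangle_residue_theorem:
  assumes "Re a < Re b" "Im a < Im b" and "finite P" "P \<subseteq> box a b"
    and "f analytic_on cbox a b - P"
  shows "contour_integral (rectpath a b) f = 2 * pi * \<i> * (\<Sum>z\<in>P. residue f z)"
proof -
  obtain U where U: "open U" "cbox a b - P \<subseteq> U" "f holomorphic_on U"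
    using assms(5) unfolding analytic_on_holomorphic by blast
  define V where "V = connected_component_set (U \<union> box a b) a"
  have sub: "box a b \<subseteq> cbox a b" by (rule box_subset_cbox)
  have "a \<in> cbox a b" using assms by (simp add: in_cbox_complex_iff)
  moreover have cU: "cbox a b \<subseteq> U \<union> box a b" using U(2) assms(4) by blast
  ultimately have cV: "cbox a b \<subseteq> V"
    unfolding V_def by (intro connected_component_maximal) (auto simp: convex_connected)
  have V: "open V" "connected V" "V \<subseteq> U \<union> box a b"
    unfolding V_def using U(1)
    by (auto intro!: open_connected_component connected_component_subset)
  have path: "path_image (rectpath a b) = cbox a b - box a b"
    using assms by (intro path_image_rectpath_cbox_minus_box) auto
  have "V - P \<subseteq> U" using V(3) U(2) sub by blast
  hence holo: "f holomorphic_on V - P" using U(3) holomorphic_on_subset by blast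
  have out: "winding_number (rectpath a b) z = 0" if "z \<notin> V" for z
    using that cV assms(1,2) by (intro winding_number_rectpath_outside) auto
  have "contour_integral (rectpath a b) f =
      2 * pi * \<i> * (\<Sum>z\<in>P. winding_number (rectpath a b) z * residue f z)"
    using holo out path assms(3,4) V cV by (intro Residue_theorem) auto
  also have "(\<Sum>z\<in>P. winding_number (rectpath a b) z * residue f z) = (\<Sum>z\<in>P. residue f z)"
    using assms(4) by (intro sum.cong) (auto simp: winding_number_rectpath)
  finally show ?thesis .
qed

text \<open>
  The symmetry, assumed between the two boundary lines only, turns the integral over the
  lower edge of a rectangle into the one over the upper edge, so the contour integral is twice
  the integral along the real axis up to the contribution of the vertical edges.
\<close>

lemma symmetric_integral_strip:
  assumes "finite P" "P \<subseteq> {z. -1 < Im z \<and> Im z < 0}" and ana: "g analytic_on strip - P"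
    and sym: "\<And>x::real. g (- of_real x - \<i>) = - g (of_real x)"
    and lim: "(g \<longlongrightarrow> 0) strip_ends"
  shows "has_symmetric_integral (\<lambda>x. g (of_real x)) (- pi * \<i> * (\<Sum>z\<in>P. residue g z))"
proof -
  define I where "I R = integral {-R..R} (\<lambda>x. g (of_real x))" for R
  define \<Sigma> where "\<Sigma> = (\<Sum>z\<in>P. residue g z)"
  have cont: "continuous_on (strip - P) g"
    using ana by (simp add: analytic_imp_holomorphic holomorphic_on_imp_continuous_on)
  have real_sub: "complex_of_real x \<in> strip - P" for x
    using assms(2) by (auto simp: strip_def)
  have intble: "(\<lambda>x. g (of_real x)) integrable_on {-R..R}" for R
    by (intro integrable_continuous_real continuous_on_compose2[OF cont] continuous_intros)
       (use real_sub in auto)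
  have bound: "norm (2 * I R + 2 * pi * \<i> * \<Sigma>) \<le> 2 * e"
    if R: "R > 0" "\<And>z. z \<in> P \<Longrightarrow> \<bar>Re z\<bar> < R" and e: "e \<ge> 0"
      "\<And>z. z \<in> strip \<Longrightarrow> \<bar>Re z\<bar> \<ge> R \<Longrightarrow> norm (g z) \<le> e" for R e
  proof -
    define a1 a2 a3 a4 where "a1 = Complex (-R) (-1)" "a2 = Complex R (-1)"
      "a3 = Complex R 0" "a4 = Complex (-R) 0"
    note a = a1_a2_a3_a4_def
    have seg: "closed_segment a1 a2 \<subseteq> strip - P" "closed_segment a2 a3 \<subseteq> strip - P"
       "closed_segment a3 a4 \<subseteq> strip - P" "closed_segment a4 a1 \<subseteq> strip - P"
      using assms(2) R(1)
      by (auto simp: a strip_def closed_segment_same_Re closed_segment_same_Im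
          closed_segment_eq_real_ivl dest: R(2))
    have i: "g contour_integrable_on linepath u v" if "closed_segment u v \<subseteq> strip - P" for u v
      using that cont by (intro contour_integrable_continuous_linepath) (rule continuous_on_subset)
    note int = seg[THEN i]
    have "contour_integral (rectpath a1 a3) g = 2 * pi * \<i> * \<Sigma>" unfolding \<Sigma>_def
    proof (rule rectangle_residue_theorem)
      show "P \<subseteq> box a1 a3"
        using assms(2) R(2) by (fastforce simp: a in_box_complex_iff abs_less_iff)
      show "g analytic_on cbox a1 a3 - P"
        by (rule analytic_on_subset[OF ana]) (auto simp: a in_cbox_complex_iff strip_def)
    qed (use R assms(1) in \<open>auto simp: a\<close>)
    moreover have "rectpath a1 a3 =
        linepath a1 a2 +++ linepath a2 a3 +++ linepath a3 a4 +++ linepath a4 a1"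
      by (simp add: rectpath_def a Let_def)
    ultimately have total: "contour_integral (linepath a1 a2) g + contour_integral (linepath a2 a3) g
        + contour_integral (linepath a3 a4) g + contour_integral (linepath a4 a1) g
        = 2 * pi * \<i> * \<Sigma>"
      using int by (simp add: add.assoc)
    have top: "contour_integral (linepath a3 a4) g = - I R"
    proof -
      have "contour_integral (linepath a4 a3) g = I R"
        unfolding I_def using R(1) by (subst contour_integral_linepath_Reals_eq) (auto simp: a complex_is_Real_iff)
      thus ?thesis using int(3)
        by (metis contour_integral_reversepath reversepath_linepath valid_path_linepath minus_minus)
    qed
    \<comment> \<open>The reflection carries the top edge, with its orientation, to the bottom edge; the sign of \<open>g\<close>
      and the sign of the tangent vector cancel.\<close>
    have bot: "contour_integral (linepath a1 a2) g = - I R"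
    proof -
      have "g (linepath a1 a2 t) * (a2 - a1) = g (linepath a3 a4 t) * (a4 - a3)" for t
      proof -
        have "linepath a3 a4 t = of_real (R - 2 * R * t)"
             "linepath a1 a2 t = - of_real (R - 2 * R * t) - \<i>"
          by (simp_all add: a linepath_def complex_eq_iff algebra_simps)
        moreover have "a2 - a1 = - (a4 - a3)" by (simp add: a complex_eq_iff)
        ultimately show ?thesis using sym[of "R - 2 * R * t"]
          by (simp only:) (simp add: algebra_simps)
      qed
      hence "(g has_contour_integral contour_integral (linepath a3 a4) g) (linepath a1 a2)"
        using has_contour_integral_integral[OF int(3)]
        by (simp only: has_contour_integral_linepath)
      thus ?thesis using top by (simp add: contour_integral_unique)
    qed
    have sides: "norm (contour_integral (linepath a2 a3) g) \<le> e * norm (a3 - a2)"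
         "norm (contour_integral (linepath a4 a1) g) \<le> e * norm (a1 - a4)"
      using R e int seg
      by (auto intro!: contour_integral_bound_linepath e(2) simp: closed_segment_same_Re a subset_iff)
    have "2 * I R + 2 * pi * \<i> * \<Sigma> =
        contour_integral (linepath a2 a3) g + contour_integral (linepath a4 a1) g"
      using total top bot by (simp add: algebra_simps)
    also have "norm \<dots> \<le> e + e"
      using sides by (intro norm_triangle_mono) (auto simp: a cmod_def)
    finally show ?thesis by simp
  qed
  have "(I \<longlongrightarrow> - pi * \<i> * \<Sigma>) at_top"
  proof (rule tendstoI)
    fix e :: real assume e: "e > 0"
    have "\<forall>\<^sub>F z in strip_ends. dist (g z) 0 < e / 2"
      using tendstoD[OF lim, of "e / 2"] e by simp
    then obtain R0 where R0: "\<And>z. z \<in> strip \<Longrightarrow> \<bar>Re z\<bar> \<ge> R0 \<Longrightarrow> norm (g z) < e / 2"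
      unfolding eventually_strip_ends by auto
    have "eventually (\<lambda>R. \<forall>z\<in>P. \<bar>Re z\<bar> < R) at_top"
      using assms(1) by (intro eventually_ball_finite) (auto intro: eventually_gt_at_top)
    thus "\<forall>\<^sub>F R in at_top. dist (I R) (- pi * \<i> * \<Sigma>) < e"
      using eventually_ge_at_top[of R0] eventually_gt_at_top[of 0]
    proof eventually_elim
      case (elim R)
      have "2 * norm (I R + pi * \<i> * \<Sigma>) = norm (2 * (I R + pi * \<i> * \<Sigma>))"
        by (simp only: norm_mult norm_numeral)
      also have "\<dots> \<le> 2 * (e / 2)"
        using bound[of R "e / 2"] elim R0 e by (force simp: algebra_simps less_imp_le)
      finally show ?case using e by (simp add: dist_norm)
    qed
  qed
  thus ?thesis using intble unfolding has_symmetric_integral_def I_def \<Sigma>_def by auto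
qed

section \<open>Simple zeros and the residues of the integrand\<close>

definition denom :: "real \<Rightarrow> complex \<Rightarrow> complex" where
  "denom p z = sinh (of_real (pi * p) * (2 * z + \<i>))"

definition node :: "real \<Rightarrow> int \<Rightarrow> complex" where
  "node p k = \<i> * of_real (of_int k - p) / of_real (2 * p)"

lemma denom_eq_0_iff:
  assumes "p > 0"
  shows "denom p z = 0 \<longleftrightarrow> (\<exists>k. z = node p k)"
proof -
  have "denom p z = 0 \<longleftrightarrow> sin (\<i> * (of_real (pi * p) * (2 * z + \<i>))) = 0"
    by (simp add: denom_def sinh_conv_sin)
  also have "\<dots> \<longleftrightarrow> (\<exists>n::int. \<i> * (of_real (pi * p) * (2 * z + \<i>)) = of_real (n * pi))"
    by (rule sin_eq_0)
  also have "\<dots> \<longleftrightarrow> (\<exists>n::int. z = node p (-n))"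
  proof (rule ex_cong1)
    fix n :: int
    show "\<i> * (of_real (pi * p) * (2 * z + \<i>)) = of_real (n * pi) \<longleftrightarrow> z = node p (-n)"
    proof -
      have "\<i> * (of_real (pi * p) * (2 * z + \<i>)) = of_real (n * pi) \<longleftrightarrow>
          pi * (p * (1 + 2 * Im z)) = pi * - n \<and> Re z = 0"
        using assms by (auto simp: complex_eq_iff algebra_simps)
      also have "\<dots> \<longleftrightarrow> p * (1 + 2 * Im z) = - n \<and> Re z = 0"
        by (simp only: mult_cancel_left) simp
      also have "\<dots> \<longleftrightarrow> z = node p (-n)"
        using assms by (auto simp: node_def complex_eq_iff field_simps)
      finally show ?thesis .
    qed
  qed
  also have "\<dots> \<longleftrightarrow> (\<exists>k. z = node p k)"
    by (metis minus_minus)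
  finally show ?thesis .
qed

lemma denom_deriv_node:
  assumes "p > 0"
  shows "(denom p has_field_derivative of_real (2 * pi * p) * (-1) powi k) (at (node p k))"
proof -
  have arg: "of_real (pi * p) * (2 * node p k + \<i>) = \<i> * (of_int k * of_real pi)"
    using assms by (simp add: node_def field_simps)
  have "cosh (\<i> * (of_int k * of_real pi) :: complex) = cos (of_int k * of_real pi)"
    by (simp add: cosh_conv_cos)
  also have "\<dots> = of_real (cos (of_int k * pi))"
    by (metis cos_of_real of_real_mult of_real_of_int_eq)
  also have "\<dots> = (-1) powi k"
    by (simp add: mult.commute[of _ pi] power_int_minus_left)
  finally have c: "cosh (of_real (pi * p) * (2 * node p k + \<i>)) = (-1) powi k"
    by (simp only: arg)
  show ?thesis unfolding denom_def [abs_def]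
    by (rule derivative_eq_intros refl)+ (simp only: c, simp)
qed

lemma simple_zero_eventually_nonzero:
  fixes h :: "complex \<Rightarrow> complex"
  assumes "(h has_field_derivative d) (at z)" "h z = 0" "d \<noteq> 0"
  shows "eventually (\<lambda>w. h w \<noteq> 0) (at z)"
proof -
  have "((\<lambda>w. (h w - h z) / (w - z)) \<longlongrightarrow> d) (at z)"
    using assms(1) by (rule has_field_derivativeD)
  hence "eventually (\<lambda>w. (h w - h z) / (w - z) \<noteq> 0) (at z)"
    using assms(3) by (rule tendsto_imp_eventually_ne)
  thus ?thesis by eventually_elim (use assms(2) in auto)
qed

text \<open>
  The numerator may vanish at the zero of the denominator, in which case the singularity is
  removable and both sides are 0. Arguing with the limit of \<open>f w * (w - z) / h w\<close>
  treats this case together with that of a genuine pole.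
\<close>

lemma residue_quotient_simple_zero:
  fixes f h :: "complex \<Rightarrow> complex"
  assumes "f analytic_on {z}" "h analytic_on {z}"
    and h: "(h has_field_derivative d) (at z)" "h z = 0" "d \<noteq> 0"
  shows "residue (\<lambda>w. f w / h w) z = f z / d"
proof -
  have "(\<lambda>w. f w / h w) meromorphic_on {z}"
    by (intro meromorphic_intros analytic_on_imp_meromorphic_on assms)
  hence "isolated_singularity_at (\<lambda>w. f w / h w) z"
    by (simp add: meromorphic_on_isolated_singularity)
  then obtain r where r: "r > 0" "(\<lambda>w. f w / h w) analytic_on ball z r - {z}"
    by (auto simp: isolated_singularity_at_def)
  obtain f' where f': "(f has_field_derivative f') (at z)"
    using assms(1) analytic_on_imp_differentiable_at field_differentiable_def by blast
  have "((\<lambda>w. f w * (w - z) / h w) \<longlongrightarrow> f z / d) (at z)"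
  proof (rule lhopital_complex_simple)
    show "((\<lambda>w. f w * (w - z)) has_field_derivative f z) (at z)"
      by (rule derivative_eq_intros f' refl | simp)+
  qed (use h in auto)
  thus ?thesis using r
    by (intro residue_simple'[of "ball z r"]) (auto intro: analytic_imp_holomorphic)
qed

section \<open>Evaluation of the integral\<close>

theorem mainTheorem16:
  fixes p :: real and F :: "complex \<Rightarrow> complex" and A :: "complex set"
  assumes "p > 0"
    and "open A" and "\<And>z. z \<in> A \<Longrightarrow> -z \<in> A" and "{x. \<bar>Im x\<bar> \<le> 1} \<subseteq> A"
    and "F analytic_on A" and "\<And>z. z \<in> A \<Longrightarrow> F (-z) = - F z"
    and "numer F \<in> o[strip_ends](\<lambda>x. of_real (exp (pi * norm x) / norm x))"
    and "(integrand p F \<longlongrightarrow> 0) strip_ends"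
    and "\<And>x::real. \<not> is_pole (integrand p F) (of_real x)"
  shows "has_symmetric_integral (\<lambda>x. remove_sings (integrand p F) (of_real x))
           (\<i> / of_real (2 * p) *
             (\<Sum>n = \<lfloor>-p\<rfloor>..-1 + \<lfloor>p\<rfloor>. (-1) powi n *
                ((F (\<i> * of_real (of_int (n + 1) - p) / of_real (2 * p)))\<^sup>2 +
                 (F (\<i> * of_real (of_int (n + 1) + p) / of_real (2 * p)))\<^sup>2)))"
proof -
  define f where "f = integrand p F"
  define P where "P = node p ` {k. \<bar>real_of_int k\<bar> < p}"
  note p = assms(1)
  have f_eq: "f = (\<lambda>z. numer F z / denom p z)"
    by (simp add: f_def integrand_def denom_def fun_eq_iff)
  have num_ana: "numer F analytic_on {z}" if "z \<in> strip" for z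
  proof -
    have "F analytic_on {w}" if "\<bar>Im w\<bar> \<le> 1" for w
      using assms(4) that by (intro analytic_on_subset[OF assms(5)]) auto
    moreover have "((\<lambda>x. F (x + \<i>)) analytic_on {z})"
    proof -
      have "F \<circ> (\<lambda>x. x + \<i>) analytic_on {z}"
        using calculation[of "z + \<i>"] that
        by (intro analytic_on_compose) (auto simp: strip_def intro!: analytic_intros)
      thus ?thesis by (simp add: o_def)
    qed
    ultimately show ?thesis using that unfolding numer_def [abs_def]
      by (intro analytic_intros) (auto simp: strip_def)
  qed
  have den_ana: "denom p analytic_on S" for S
  proof -
    have "denom p holomorphic_on UNIV"
      unfolding denom_def [abs_def] sinh_conv_sin by (intro holomorphic_intros)
    thus ?thesis by (meson analytic_on_open analytic_on_subset open_UNIV subset_UNIV)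
  qed
  have mero: "f meromorphic_on {z}" if "z \<in> strip" for z
    unfolding f_eq using num_ana[OF that] den_ana
    by (intro meromorphic_intros analytic_on_imp_meromorphic_on)
  have iso: "isolated_singularity_at f z" if "z \<in> strip" for z
    using mero[OF that] by (simp add: meromorphic_on_isolated_singularity)
  have f_sym: "f (- z - \<i>) = - f z" if "z \<in> A" "z + \<i> \<in> A" for z
  proof -
    have "F (- z - \<i>) = - F (z + \<i>)" "F (- z) = - F z"
      using assms(6)[OF that(1)] assms(6)[OF that(2)] by simp_all
    hence "numer F (- z - \<i>) = numer F z"
      by (simp add: numer_def algebra_simps)
    moreover have "denom p (- z - \<i>) = - denom p z"
      unfolding denom_def by (subst sinh_minus [symmetric]) (simp add: algebra_simps)
    ultimately show ?thesis by (simp add: f_eq)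
  qed
  have ev_sym: "eventually (\<lambda>w. f (- w - \<i>) = - f w) (at z)" if "z \<in> strip" for z
  proof -
    have "open (A \<inter> (\<lambda>x. x + \<i>) -` A)"
      using assms(2) by (intro open_Int open_vimage continuous_intros)
    moreover have "z \<in> A \<inter> (\<lambda>x. x + \<i>) -` A"
      using that assms(4) by (auto simp: strip_def)
    ultimately have "eventually (\<lambda>w. w \<in> A \<inter> (\<lambda>x. x + \<i>) -` A) (at z)"
      by (rule eventually_at_in_open')
    thus ?thesis by eventually_elim (use f_sym in auto)
  qed
  \<comment> \<open>Absence of poles is known on the real axis only; the symmetry transports it to the lower
    boundary line.\<close>
  have lims: "\<exists>c. f \<midarrow>of_real x\<rightarrow> c \<and> f \<midarrow>- of_real x - \<i>\<rightarrow> - c" for x :: real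
  proof -
    have "not_essential f (of_real x)"
      using mero[of "of_real x"] by (auto simp: strip_def meromorphic_on_not_essential)
    then obtain c where c: "f \<midarrow>of_real x\<rightarrow> c"
      using assms(9)[of x] by (auto simp: not_essential_def f_def)
    have "filterlim (\<lambda>w. - w - \<i>) (at (of_real x)) (at (- of_real x - \<i>))"
    proof (rule filterlim_atI)
      have "- w - \<i> \<noteq> of_real x" if "w \<noteq> - of_real x - \<i>" for w :: complex
        using that by (auto simp: complex_eq_iff)
      thus "\<forall>\<^sub>F w in at (- of_real x - \<i>). - w - \<i> \<noteq> complex_of_real x"
        by (simp add: eventually_at_filter)
    qed (auto intro!: tendsto_eq_intros)
    hence "(\<lambda>w. - f (- w - \<i>)) \<midarrow>- of_real x - \<i>\<rightarrow> - c"
      by (intro tendsto_minus filterlim_compose[OF c])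
    moreover have "eventually (\<lambda>w. - f (- w - \<i>) = f w) (at (- of_real x - \<i>))"
      using ev_sym[of "- of_real x - \<i>"] by (auto simp: strip_def elim: eventually_mono)
    ultimately show ?thesis using c Lim_transform_eventually by blast
  qed
  have node_Im: "Im (node p k) = (k - p) / (2 * p)" and node_Re: "Re (node p k) = 0" for k
    using p by (simp_all add: node_def)
  have ana_off: "f analytic_on {z}" if "z \<in> strip" "denom p z \<noteq> 0" for z
    unfolding f_eq using num_ana den_ana that by (intro analytic_intros) auto
  have ana: "remove_sings f analytic_on {z}" if z: "z \<in> strip - P" for z
  proof -
    consider "Im z = 0" | "Im z = -1" | "-1 < Im z" "Im z < 0"
      using z by (force simp: strip_def)
    thus ?thesis
    proof cases
      case 1
      hence "z = of_real (Re z)" by (simp add: complex_eq_iff)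
      thus ?thesis using lims[of "Re z"] iso z by (metis DiffD1 remove_sings_analytic_at)
    next
      case 2
      hence "z = - of_real (- Re z) - \<i>" by (simp add: complex_eq_iff)
      thus ?thesis using lims[of "- Re z"] iso z by (metis DiffD1 remove_sings_analytic_at)
    next
      case 3
      have "denom p z \<noteq> 0"
      proof
        assume "denom p z = 0"
        then obtain k where k: "z = node p k" using denom_eq_0_iff[OF p] by blast
        have "\<bar>real_of_int k\<bar> < p" using 3 p by (simp add: k node_Im field_simps abs_less_iff)
        thus False using z k by (auto simp: P_def)
      qed
      thus ?thesis using ana_off z by (intro remove_sings_analytic_on) auto
    qed
  qed
  have finK: "finite {k. \<bar>real_of_int k\<bar> < p}"
    by (rule finite_subset[of _ "{\<lfloor>-p\<rfloor>..\<lceil>p\<rceil>}"]) (auto simp: floor_le_iff le_ceiling_iff)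
  have P_in: "P \<subseteq> {z. -1 < Im z \<and> Im z < 0}"
    using p by (auto simp: P_def node_Im field_simps abs_less_iff)
  have res: "residue (remove_sings f) (node p k) = (-1) powi k * numer F (node p k) / (2 * pi * p)"
    if "\<bar>real_of_int k\<bar> < p" for k
  proof -
    have str: "node p k \<in> strip" using P_in that by (fastforce simp: P_def strip_def)
    have "residue f (node p k) = numer F (node p k) / (of_real (2 * pi * p) * (-1) powi k)"
      unfolding f_eq using str num_ana den_ana p denom_eq_0_iff[OF p]
      by (intro residue_quotient_simple_zero denom_deriv_node) auto
    also have "\<dots> = (-1) powi k * numer F (node p k) / (2 * pi * p)"
      by (simp add: power_int_minus_left)
    finally show ?thesis using iso[OF str] by simp
  qed
  have "has_symmetric_integral (\<lambda>x. remove_sings f (of_real x))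
          (- pi * \<i> * (\<Sum>z\<in>P. residue (remove_sings f) z))"
  proof (rule symmetric_integral_strip[OF _ P_in])
    show "finite P" using finK by (simp add: P_def)
    show "remove_sings f analytic_on strip - P"
      using ana analytic_on_analytic_at by blast
    show "remove_sings f (- of_real x - \<i>) = - remove_sings f (of_real x)" for x
      using lims[of x] remove_sings_eqI by metis
    show "(remove_sings f \<longlongrightarrow> 0) strip_ends"
    proof (rule Lim_transform_eventually)
      show "(f \<longlongrightarrow> 0) strip_ends" using assms(8) by (simp add: f_def)
      have "f z = remove_sings f z" if "z \<in> strip" "\<bar>Re z\<bar> \<ge> 1" for z
        using that ana_off[of z] node_Re denom_eq_0_iff[OF p, of z] by fastforce
      thus "\<forall>\<^sub>F z in strip_ends. f z = remove_sings f z"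
        unfolding eventually_strip_ends by blast
    qed
  qed
  also have "- pi * \<i> * (\<Sum>z\<in>P. residue (remove_sings f) z) =
      \<i> / of_real (2 * p) *
      (\<Sum>k | \<bar>real_of_int k\<bar> < p. (-1) powi (k - 1) * numer F (node p k))"
  proof -
    have "inj (node p)" using p by (auto simp: inj_def node_def)
    hence "(\<Sum>z\<in>P. residue (remove_sings f) z) =
        (\<Sum>k | \<bar>real_of_int k\<bar> < p. residue (remove_sings f) (node p k))"
      unfolding P_def by (subst sum.reindex) (auto intro: inj_on_subset)
    also have "\<dots> = (\<Sum>k | \<bar>real_of_int k\<bar> < p.
        - ((-1) powi (k - 1) * numer F (node p k)) / (2 * pi * p))"
      by (intro sum.cong) (auto simp: res power_int_diff)
    also have "\<dots> = - (\<Sum>k | \<bar>real_of_int k\<bar> < p.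
        (-1) powi (k - 1) * numer F (node p k)) / (2 * pi * p)"
      by (simp add: sum_negf flip: sum_divide_distrib)
    finally show ?thesis by (simp add: field_simps)
  qed
  \<comment> \<open>The two ranges differ only for integer \<open>p\<close>, and then only by \<open>k = p\<close>, that is, by the node 0
    on the real axis.\<close>
  also have "(\<Sum>k | \<bar>real_of_int k\<bar> < p. (-1) powi (k - 1) * numer F (node p k)) =
      (\<Sum>k = \<lfloor>-p\<rfloor> + 1..\<lfloor>p\<rfloor>. (-1) powi (k - 1) * numer F (node p k))"
  proof (rule sum.mono_neutral_left)
    show "{k. \<bar>real_of_int k\<bar> < p} \<subseteq> {\<lfloor>-p\<rfloor> + 1..\<lfloor>p\<rfloor>}"
      by (auto simp: le_floor_iff abs_less_iff) linarith
    show "\<forall>k\<in>{\<lfloor>-p\<rfloor> + 1..\<lfloor>p\<rfloor>} - {k. \<bar>real_of_int k\<bar> < p}.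
        (-1) powi (k - 1) * numer F (node p k) = 0"
    proof
      fix k assume "k \<in> {\<lfloor>-p\<rfloor> + 1..\<lfloor>p\<rfloor>} - {k. \<bar>real_of_int k\<bar> < p}"
      hence kp: "real_of_int k = p" by (auto simp: abs_less_iff) linarith+
      hence n0: "node p k = 0" by (simp add: node_def)
      have str: "(0::complex) \<in> strip" by (simp add: strip_def)
      have d0: "denom p 0 = 0" using denom_eq_0_iff[OF p] n0 by metis
      have "numer F 0 = 0"
      proof (rule ccontr)
        assume nz: "numer F 0 \<noteq> 0"
        have "eventually (\<lambda>w. denom p w \<noteq> 0) (at 0)"
          using denom_deriv_node[OF p, of k] d0 p
          by (intro simple_zero_eventually_nonzero) (auto simp: n0)
        moreover have "denom p \<midarrow>0\<rightarrow> 0"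
          using analytic_at_imp_isCont[OF den_ana, of 0] d0 by (simp add: isCont_def)
        ultimately have "filterlim (denom p) (at 0) (at 0)"
          by (simp add: filterlim_at)
        hence "is_pole f 0" unfolding f_eq
          using analytic_at_imp_isCont[OF num_ana[OF str]] nz by (intro is_pole_divide)
        thus False using assms(9)[of 0] by (simp add: f_def)
      qed
      thus "(-1) powi (k - 1) * numer F (node p k) = 0" by (simp add: n0)
    qed
  qed simp
  also have "\<dots> = (\<Sum>n = \<lfloor>-p\<rfloor>..-1 + \<lfloor>p\<rfloor>. (-1) powi n * numer F (node p (n + 1)))"
    by (rule sum.reindex_bij_witness[of _ "\<lambda>n. n + 1" "\<lambda>k. k - 1"]) auto
  also have "(\<lambda>n. numer F (node p (n + 1))) = (\<lambda>n.
      (F (\<i> * of_real (of_int (n + 1) - p) / of_real (2 * p)))\<^sup>2 +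
      (F (\<i> * of_real (of_int (n + 1) + p) / of_real (2 * p)))\<^sup>2)"
  proof
    fix n
    have "node p (n + 1) + \<i> = \<i> * of_real (of_int (n + 1) + p) / of_real (2 * p)"
      using p by (simp add: node_def field_simps)
    thus "numer F (node p (n + 1)) =
        (F (\<i> * of_real (of_int (n + 1) - p) / of_real (2 * p)))\<^sup>2 +
        (F (\<i> * of_real (of_int (n + 1) + p) / of_real (2 * p)))\<^sup>2"
      by (simp add: numer_def node_def)
  qed
  finally show ?thesis unfolding f_def .
qed

end
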